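(* Let $n\ge 1$, let $A=\{A_1,\dots,A_n\}$ be a finite set (source alphabet), let $q\neq 1$ be a real number, and let $f=(f_1,\dots,f_n)$ be a probability vector with $f_i>0$ for all $i$. Let $a>0$ and $b$ be real constants. Consider the probability vectors $p=(p_1,\dots,p_n)$ assigned to $A$ (with $p_i>0$ and $\sum_{i=1}^n p_i=1$) that satisfy the constraint $$\sum_{i=1}^n p_i f_i^{\,q-1}=\text{constant},$$ where $f$ itself is an achievable state, so that the constant equals $\sum_{i=1}^n f_i^{\,q}$. Then the equilibrium distribution obtained from the target function $aS_q+b$ under this constraint, where $$S_q(p)=\frac{1}{q-1}\sum_{i=1}^n p_i\left(1-p_i^{\,q-1}\right),$$ is $f$ and only $f$; that is, $f$ is the unique maximizer of $aS_q(p)+b$ over all probability vectors $p$ with positive entries satisfying $\sum_{i=1}^n p_i f_i^{\,q-1}=\sum_{i=1}^n f_i^{\,q}$.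
   Context: $S_q$ is the Tsallis entropy with parameter $q$. The "equilibrium distribution" for a target function $S$ under given constraints is the probability vector which, according to the Maximal Entropy Principle, maximizes $S(p)$ among all probability vectors $p$ satisfying the constraints (including the natural constraint $\sum_i p_i=1$). "Achievable state" means that $f$ is one of the probability vectors satisfying the constraint. "Constant" means that the left-hand side takes the same value for all admissible $p$.
   Formalization: The formal theorem assumes q > 0 in addition to q ≠ 1; for q ≤ 0 the claim is false (S_q is constant on positive vectors at q = 0 and strictly convex for q < 0), e.g. for f uniform on two letters, and holds only when f is the sole admissible vector. *)

theory Defs
  imports "HOL-Analysis.Analysis"
begin

text \<open>The alphabet is the (nonempty, finite) index type, so a distribution on it is a vector.\<close>

definition pos_prob_vec :: "real ^ 'n::finite \<Rightarrow> bool" where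
  "pos_prob_vec p \<longleftrightarrow> (\<forall>i. 0 < p $ i) \<and> (\<Sum>i\<in>UNIV. p $ i) = 1"

definition tsallis_entropy :: "real \<Rightarrow> real ^ 'n::finite \<Rightarrow> real" where
  "tsallis_entropy q p = 1 / (q - 1) * (\<Sum>i\<in>UNIV. p $ i * (1 - p $ i powr (q - 1)))"

definition is_equilibrium ::
    "(real ^ 'n::finite \<Rightarrow> real) \<Rightarrow> (real ^ 'n \<Rightarrow> bool) \<Rightarrow> real ^ 'n \<Rightarrow> bool" where
  "is_equilibrium S C p \<longleftrightarrow> is_arg_max S (\<lambda>p. pos_prob_vec p \<and> C p) p"

text \<open>
  The Tsallis entropy is strictly concave only for positive \<open>q\<close>. For every \<open>q \<le> 0\<close> the
  uniform distribution on two letters fails to be the unique maximizer under its own constraint,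
  so the positivity of \<open>q\<close> cannot be dropped from the characterization of equilibria.
\<close>

lemma equilibrium_fails_nonpos:
  fixes q a b :: real
  assumes q: "q \<le> 0" and a: "a > 0"
  defines "f \<equiv> (\<chi> i. 1 / 2) :: real ^ 2"
  shows "pos_prob_vec f"
    and "\<not> (\<forall>p. is_equilibrium (\<lambda>p. a * tsallis_entropy q p + b)
      (\<lambda>p. (\<Sum>i\<in>UNIV. p $ i * f $ i powr (q - 1)) = (\<Sum>i\<in>UNIV. f $ i powr q)) p
                \<longleftrightarrow> p = f)"
proof -
  show f: "pos_prob_vec f"
    by (simp add: f_def pos_prob_vec_def)
  define p :: "real ^ 2" where "p = (\<chi> i. if i = 1 then 1 / 4 else 3 / 4)"
  have p_nth: "p $ 1 = 1 / 4" "p $ 2 = 3 / 4"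
    by (simp_all add: p_def)
  have p: "pos_prob_vec p"
    by (auto simp: pos_prob_vec_def sum_2 p_nth forall_2)
  have half: "(1 / 2 :: real) * (1 / 2) powr (q - 1) = (1 / 2) powr q"
    by (simp add: powr_diff)
  have quarter: "(1 / 4 :: real) * (1 / 4) powr (q - 1) = (1 / 4) powr q"
    by (simp add: powr_diff)
  have three: "(3 / 4 :: real) * (3 / 4) powr (q - 1) = (3 / 4) powr q"
    by (simp add: powr_diff)
  have Cp: "(\<Sum>i\<in>UNIV. p $ i * f $ i powr (q - 1)) = (\<Sum>i\<in>UNIV. f $ i powr q)"
    using half by (simp add: sum_2 p_nth f_def)
  define u v w where "u = (1 / 4 :: real) powr q" and "v = (3 / 4 :: real) powr q"
    and "w = (1 / 2 :: real) powr q"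
  have pos: "u > 0" "v > 0" "w > 0"
    by (simp_all add: u_def v_def w_def)
  have "w\<^sup>2 = (1 / 4) powr q"
    using powr_mult[of "1 / 2 :: real" "1 / 2" q] by (simp add: w_def power2_eq_square)
  also have "\<dots> \<le> (3 / 16) powr q"
    using q by (intro powr_mono2') auto
  also have "\<dots> = u * v"
    using powr_mult[of "1 / 4 :: real" "3 / 4" q] by (simp add: u_def v_def)
  finally have uv: "w\<^sup>2 \<le> u * v" .
  have "0 \<le> (u - v)\<^sup>2"
    by simp
  with uv have "(2 * w)\<^sup>2 \<le> (u + v)\<^sup>2"
    by (simp add: power2_eq_square algebra_simps)
  moreover have "0 \<le> u + v"
    using pos by simp
  ultimately have "2 * w \<le> u + v"
    by (rule power2_le_imp_le)
  moreover have "tsallis_entropy q f = 1 / (q - 1) * (1 - 2 * w)"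
    using half by (simp add: tsallis_entropy_def sum_2 f_def w_def algebra_simps)
  moreover have "tsallis_entropy q p = 1 / (q - 1) * (1 - (u + v))"
  proof -
    have "(\<Sum>i\<in>UNIV. p $ i * (1 - p $ i powr (q - 1))) =
        1 / 4 - 1 / 4 * (1 / 4) powr (q - 1) + (3 / 4 - 3 / 4 * (3 / 4) powr (q - 1))"
      unfolding sum_2 p_nth by (simp only: right_diff_distrib mult_1_right)
    also have "\<dots> = 1 - (u + v)"
      unfolding quarter three u_def v_def by simp
    finally show ?thesis
      by (simp only: tsallis_entropy_def)
  qed
  moreover have "1 / (q - 1) * (1 - 2 * w) \<le> 1 / (q - 1) * (1 - (u + v))"
    if "2 * w \<le> u + v"
    using q that by (intro mult_left_mono_neg) auto
  ultimately have "tsallis_entropy q f \<le> tsallis_entropy q p"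
    by metis
  then have le: "a * tsallis_entropy q f + b \<le> a * tsallis_entropy q p + b"
    using a by simp
  have "p $ 1 \<noteq> f $ 1"
    by (simp add: p_nth f_def)
  then have "p \<noteq> f"
    by metis
  show "\<not> (\<forall>p. is_equilibrium (\<lambda>p. a * tsallis_entropy q p + b)
      (\<lambda>p. (\<Sum>i\<in>UNIV. p $ i * f $ i powr (q - 1)) = (\<Sum>i\<in>UNIV. f $ i powr q)) p \<longleftrightarrow> p = f)"
    (is "\<not> ?unique")
  proof
    assume U: ?unique
    then have "is_equilibrium (\<lambda>p. a * tsallis_entropy q p + b)
      (\<lambda>p. (\<Sum>i\<in>UNIV. p $ i * f $ i powr (q - 1)) = (\<Sum>i\<in>UNIV. f $ i powr q)) f"
      by blast
    then have "is_equilibrium (\<lambda>p. a * tsallis_entropy q p + b)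
      (\<lambda>p. (\<Sum>i\<in>UNIV. p $ i * f $ i powr (q - 1)) = (\<Sum>i\<in>UNIV. f $ i powr q)) p"
      using p Cp le unfolding is_equilibrium_def is_arg_max_linorder by (auto intro: order_trans)
    with U \<open>p \<noteq> f\<close> show False
      by blast
  qed
qed

end

theory Submission
  imports Defs
begin

text \<open>
  The function \<open>x \<mapsto> x powr q / (q - 1)\<close> is strictly convex on the positive reals when \<open>q > 0\<close>,
  so it lies strictly above its tangent lines. Summing the tangent inequalities at the points
  \<open>f $ i\<close>, the linear terms add up to a multiple of \<open>\<Sum>i. f $ i powr (q - 1) * (p $ i - f $ i)\<close>,
  which is exactly what the constraint makes vanish.
\<close>

text \<open>Dividing by \<open>r\<close> cancels the change of monotonicity of
  \<open>t powr r\<close> at \<open>r = 0\<close>. With \<open>r = q - 1\<close>, the cases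
  \<open>q < 1\<close> and \<open>q > 1\<close> need no separate treatment later.\<close>

lemma powr_diff_divide_pos:
  fixes x y r :: real
  assumes "r \<noteq> 0" and "0 < x" and "x < y"
  shows "0 < (y powr r - x powr r) / r"
proof (cases "r > 0")
  case True
  then show ?thesis
    using assms by (simp add: powr_less_mono2)
next
  case False
  then have "y powr r < x powr r"
    using assms by (intro powr_less_mono2_neg) auto
  then show ?thesis
    using False assms by (intro divide_neg_neg) auto
qed

lemma powr_above_tangent:
  fixes x y q :: real
  assumes q: "q > 0" "q \<noteq> 1" and xy: "0 < x" "0 < y" "x \<noteq> y"
  shows "q * y powr (q - 1) * (x - y) / (q - 1) < (x powr q - y powr q) / (q - 1)"
proof -
  have deriv: "((\<lambda>t. t powr q) has_real_derivative q * t powr (q - 1)) (at t)" if "0 < t" for t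
    using that by (rule has_real_derivative_powr)
  \<comment> \<open>The witness \<open>z\<close> is the mean value point strictly between
    \<open>x\<close> and \<open>y\<close>. It lies on the same side of \<open>y\<close> as
    \<open>x\<close> does, so both factors of the second product have the same sign.\<close>
  have "\<exists>z. x powr q - y powr q = (x - y) * (q * z powr (q - 1)) \<and>
      0 < (x - y) * ((z powr (q - 1) - y powr (q - 1)) / (q - 1))"
  proof (cases "y < x")
    case True
    obtain z where z: "y < z" "z < x" "x powr q - y powr q = (x - y) * (q * z powr (q - 1))"
      using MVT2[OF True, of "\<lambda>t. t powr q"] deriv xy by (meson order_less_le_trans)
    have "0 < (z powr (q - 1) - y powr (q - 1)) / (q - 1)"
      using powr_diff_divide_pos[of "q - 1" y z] q xy z by simp
    then show ?thesis
      using z True by (intro exI[of _ z] conjI mult_pos_pos) auto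
  next
    case False
    then have "x < y"
      using xy by simp
    obtain z where z: "x < z" "z < y" "y powr q - x powr q = (y - x) * (q * z powr (q - 1))"
      using MVT2[OF \<open>x < y\<close>, of "\<lambda>t. t powr q"] deriv xy by (meson order_less_le_trans)
    have "0 < (y powr (q - 1) - z powr (q - 1)) / (q - 1)"
      using powr_diff_divide_pos[of "q - 1" z y] q xy z by simp
    then have "(z powr (q - 1) - y powr (q - 1)) / (q - 1) < 0"
      by (metis minus_diff_eq minus_divide_left neg_0_less_iff_less)
    moreover have "x powr q - y powr q = (x - y) * (q * z powr (q - 1))"
      using z(3) by (simp add: algebra_simps)
    ultimately show ?thesis
      using \<open>x < y\<close> by (intro exI[of _ z] conjI mult_neg_neg) auto
  qed
  then obtain z where z: "x powr q - y powr q = (x - y) * (q * z powr (q - 1))"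
    and pos: "0 < (x - y) * ((z powr (q - 1) - y powr (q - 1)) / (q - 1))"
    by blast
  \<comment> \<open>This product is exactly the gap between the curve and its tangent at
    \<open>y\<close>; the sign of \<open>q\<close> decides its sign.\<close>
  have "0 < q * ((x - y) * ((z powr (q - 1) - y powr (q - 1)) / (q - 1)))"
    using q(1) pos by (rule mult_pos_pos)
  also have "\<dots> = (x powr q - y powr q) / (q - 1) - q * y powr (q - 1) * (x - y) / (q - 1)"
    unfolding z by (simp add: diff_divide_distrib algebra_simps)
  finally show ?thesis
    by simp
qed

lemma mult_powr_minus_one:
  fixes x q :: real
  assumes "0 < x"
  shows "x * x powr (q - 1) = x powr q"
  using assms by (simp add: powr_diff)

lemma tsallis_entropy_pos_prob_vec:
  assumes "pos_prob_vec p"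
  shows "tsallis_entropy q p = (1 - (\<Sum>i\<in>UNIV. p $ i powr q)) / (q - 1)"
  using assms
  by (simp add: tsallis_entropy_def pos_prob_vec_def right_diff_distrib mult_powr_minus_one
      sum_subtractf diff_divide_distrib)

lemma tsallis_entropy_less:
  fixes f p :: "real ^ 'n::finite"
  assumes q: "q > 0" "q \<noteq> 1" and f: "pos_prob_vec f" and p: "pos_prob_vec p"
    and C: "(\<Sum>i\<in>UNIV. p $ i * f $ i powr (q - 1)) = (\<Sum>i\<in>UNIV. f $ i powr q)"
    and "p \<noteq> f"
  shows "tsallis_entropy q p < tsallis_entropy q f"
proof -
  have pos: "0 < p $ i" "0 < f $ i" for i
    using f p by (auto simp: pos_prob_vec_def)
  let ?l = "\<lambda>i. q * f $ i powr (q - 1) * (p $ i - f $ i) / (q - 1)"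
  let ?r = "\<lambda>i. (p $ i powr q - f $ i powr q) / (q - 1)"
  have "(\<Sum>i\<in>UNIV. f $ i powr (q - 1) * (p $ i - f $ i)) = 0"
    using C pos by (simp add: algebra_simps sum_subtractf mult_powr_minus_one)
  then have "(\<Sum>i\<in>UNIV. ?l i) = 0"
    by (simp add: sum_divide_distrib[symmetric] sum_distrib_left[symmetric] mult.assoc)
  \<comment> \<open>Coordinates where \<open>p\<close> and \<open>f\<close> agree contribute zero to
    both sides; strictness comes from a coordinate where they differ.\<close>
  moreover have "(\<Sum>i\<in>UNIV. ?l i) < (\<Sum>i\<in>UNIV. ?r i)"
  proof (rule sum_strict_mono_ex1)
    show "\<forall>i\<in>UNIV. ?l i \<le> ?r i"
    proof
      fix i
      show "?l i \<le> ?r i"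
        using powr_above_tangent[OF q pos(1)[of i] pos(2)[of i]] by (cases "p $ i = f $ i") auto
    qed
    obtain i where "p $ i \<noteq> f $ i"
      using \<open>p \<noteq> f\<close> by (auto simp: vec_eq_iff)
    then show "\<exists>i\<in>UNIV. ?l i < ?r i"
      using powr_above_tangent[OF q pos(1)[of i] pos(2)[of i]] by blast
  qed simp
  ultimately have "0 < (\<Sum>i\<in>UNIV. ?r i)"
    by simp
  \<comment> \<open>Both vectors sum to 1, so the terms \<open>1 / (q - 1)\<close> of the two
    entropies cancel.\<close>
  also have "\<dots> = tsallis_entropy q f - tsallis_entropy q p"
    using f p by (simp add: tsallis_entropy_pos_prob_vec sum_divide_distrib[symmetric]
        sum_subtractf diff_divide_distrib)
  finally show ?thesis
    by simp
qed

theorem theorem4: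
  fixes q a b :: real and f :: "real ^ 'n::finite"
  assumes "q \<noteq> 1" and "q > 0" and "a > 0" and "pos_prob_vec f"
  shows "\<forall>p. is_equilibrium (\<lambda>p. a * tsallis_entropy q p + b)
               (\<lambda>p. (\<Sum>i\<in>UNIV. p $ i * f $ i powr (q - 1)) = (\<Sum>i\<in>UNIV. f $ i powr q)) p
             \<longleftrightarrow> p = f"
proof -
  define C where "C p \<longleftrightarrow> pos_prob_vec p \<and>
    (\<Sum>i\<in>UNIV. p $ i * f $ i powr (q - 1)) = (\<Sum>i\<in>UNIV. f $ i powr q)" for p :: "real ^ 'n"
  let ?S = "\<lambda>p :: real ^ 'n. a * tsallis_entropy q p + b"
  have f: "C f"
    using assms by (simp add: C_def pos_prob_vec_def mult_powr_minus_one)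
  have less: "?S p < ?S f" if "C p" "p \<noteq> f" for p
    using tsallis_entropy_less[of q f p] that assms by (simp add: C_def)
  \<comment> \<open>The strict inequality serves both directions: any other admissible
    \<open>p\<close> is beaten by \<open>f\<close>, and by asymmetry none beats
    \<open>f\<close>.\<close>
  have "is_arg_max ?S C p \<longleftrightarrow> p = f" for p
    unfolding is_arg_max_def using f less by (metis less_asym)
  then show ?thesis
    by (simp add: is_equilibrium_def C_def[abs_def])
qed

end
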